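(* Let $\Omega_0=\{1,2,3\}$ with counting measure, $p=(1/3,1/3,1/3)$, $\mathbf w=(1,1,1)$, and for a fixed real $\alpha\neq0$ let \[ h_1=\alpha(2,-1,-1),\quad h_2=\alpha(-1,2,-1),\quad h_3=\alpha(-1,-1,2),\qquad p_i^\varepsilon=p+\varepsilon h_i\quad(i=1,2,3). \] Let $f:(0,\infty)\to\mathbb R$ be convex and $C^3$ in a neighborhood of $1$, with $f(1)=f'(1)=0$, $f''(1)>0$ and $f'''(1)\neq0$. Then square-root transformed-weight divergence balancing satisfies, as $\varepsilon\to0$, \[ F_{((12)3),\mathbf w}^{\varepsilon}-F_{1(23),\mathbf w}^{\varepsilon}=-\varepsilon^2\,\frac{3\alpha^2}{4}\,\frac{f'''(1)}{f''(1)}\,(1,0,-1)+o(\varepsilon^2). \]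
   Context: Densities on $\Omega_0$ are probability vectors; for small $|\varepsilon|$ the $p_i^\varepsilon$ are strictly positive probability vectors. $D_f(r\|q)=\sum_{x\in\Omega_0} q(x)f(r(x)/q(x))$. Mass-carrying divergence-balancing protocol: the input at leaf $i$ is the state $(G_i,p_i^\varepsilon)$ with $G_i=\sqrt{w_i}=1$. A merge of adjacent blocks with states $(G_A,q_A^\varepsilon)$ (left) and $(G_B,q_B^\varepsilon)$ (right) yields the state $(G_{AB},q_{AB}^\varepsilon)$ with $G_{AB}=G_A+G_B$ and $q_{AB}^\varepsilon=(1-t)q_A^\varepsilon+tq_B^\varepsilon$, where $t=t_{AB}^\varepsilon\in[0,1]$ is the local solution of \[ G_A^2D_f(q_A^\varepsilon\|(1-t)q_A^\varepsilon+tq_B^\varepsilon)=G_B^2D_f(q_B^\varepsilon\|(1-t)q_A^\varepsilon+tq_B^\varepsilon) \] converging to $\frac{G_B}{G_A+G_B}$ as $\varepsilon\to0$ (for small $\varepsilon\ne0$, the unique solution in a fixed small neighborhood of that value). $F_{((12)3),\mathbf w}^\varepsilon$ is the density obtained by first merging leaves $1,2$ and then merging the result with leaf $3$; $F_{1(23),\mathbf w}^\varepsilon$ is the density obtained by first merging leaves $2,3$ and then merging leaf $1$ (left) with the result (right). *)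

theory Defs
  imports "HOL-Analysis.Analysis" "HOL-Library.Landau_Symbols"
begin

definition C_k_on :: "nat \<Rightarrow> (real \<Rightarrow> real) \<Rightarrow> real set \<Rightarrow> bool" where
  "C_k_on k f U \<longleftrightarrow>
     (\<forall>j<k. (deriv ^^ j) f differentiable_on U) \<and> continuous_on U ((deriv ^^ k) f)"

definition f_divergence :: "(real \<Rightarrow> real) \<Rightarrow> real ^ 'n \<Rightarrow> real ^ 'n \<Rightarrow> real" where
  "f_divergence f r q = (\<Sum>x\<in>UNIV. q $ x * f (r $ x / q $ x))"

definition mixture :: "real ^ 'n \<Rightarrow> real ^ 'n \<Rightarrow> real \<Rightarrow> real ^ 'n" where
  "mixture q r t = (1 - t) *\<^sub>R q + t *\<^sub>R r"

definition balances ::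
  "(real \<Rightarrow> real) \<Rightarrow> real \<Rightarrow> real ^ 'n \<Rightarrow> real \<Rightarrow> real ^ 'n \<Rightarrow> real \<Rightarrow> bool" where
  "balances f G\<^sub>A q\<^sub>A G\<^sub>B q\<^sub>B t \<longleftrightarrow> t \<in> {0..1} \<and>
     G\<^sub>A\<^sup>2 * f_divergence f q\<^sub>A (mixture q\<^sub>A q\<^sub>B t) = G\<^sub>B\<^sup>2 * f_divergence f q\<^sub>B (mixture q\<^sub>A q\<^sub>B t)"

text \<open>
  Families of densities are functions of the perturbation parameter \<open>\<epsilon>\<close>, and the filter
  \<open>at 0\<close> excludes \<open>\<epsilon> = 0\<close>.  The neighbourhood radius \<open>\<delta>\<close> is chosen independently of \<open>\<epsilon>\<close>.
  A local solution is determined for all small \<open>\<epsilon> \<noteq> 0\<close> only; at \<open>\<epsilon> = 0\<close> the two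
  densities may coincide, and then every weight balances.
\<close>
definition local_solution ::
  "(real \<Rightarrow> real) \<Rightarrow> real \<Rightarrow> (real \<Rightarrow> real ^ 'n) \<Rightarrow> real \<Rightarrow> (real \<Rightarrow> real ^ 'n) \<Rightarrow> (real \<Rightarrow> real) \<Rightarrow> bool"
  where
  "local_solution f G\<^sub>A q\<^sub>A G\<^sub>B q\<^sub>B t \<longleftrightarrow>
     (t \<longlongrightarrow> G\<^sub>B / (G\<^sub>A + G\<^sub>B)) (at 0) \<and>
     (\<exists>\<delta>>0. \<forall>\<^sub>F \<epsilon> in at 0.
        balances f G\<^sub>A (q\<^sub>A \<epsilon>) G\<^sub>B (q\<^sub>B \<epsilon>) (t \<epsilon>) \<and>
        (\<forall>s \<in> ball (G\<^sub>B / (G\<^sub>A + G\<^sub>B)) \<delta>.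
           balances f G\<^sub>A (q\<^sub>A \<epsilon>) G\<^sub>B (q\<^sub>B \<epsilon>) s \<longrightarrow> s = t \<epsilon>))"

datatype 'i bracketing = Leaf 'i | Merge "'i bracketing" "'i bracketing"

text \<open>
  \<open>protocol_output f w p T G q\<close>: running the protocol along the bracketing \<open>T\<close>, with weights \<open>w\<close>
  and leaf densities \<open>p i \<epsilon>\<close>, can end in the state \<open>(G, q \<epsilon>)\<close>.  It is a relation because
  a local solution need not exist, and is not determined at every \<open>\<epsilon>\<close>.
\<close>
inductive protocol_output ::
  "(real \<Rightarrow> real) \<Rightarrow> ('i \<Rightarrow> real) \<Rightarrow> ('i \<Rightarrow> real \<Rightarrow> real ^ 'n) \<Rightarrow>
     'i bracketing \<Rightarrow> real \<Rightarrow> (real \<Rightarrow> real ^ 'n) \<Rightarrow> bool"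
  for f w p where
  Leaf: "protocol_output f w p (Leaf i) (sqrt (w i)) (p i)"
| Merge: "protocol_output f w p L G\<^sub>A q\<^sub>A \<Longrightarrow> protocol_output f w p R G\<^sub>B q\<^sub>B \<Longrightarrow>
    local_solution f G\<^sub>A q\<^sub>A G\<^sub>B q\<^sub>B t \<Longrightarrow>
    protocol_output f w p (Merge L R) (G\<^sub>A + G\<^sub>B) (\<lambda>\<epsilon>. mixture (q\<^sub>A \<epsilon>) (q\<^sub>B \<epsilon>) (t \<epsilon>))"

end

theory Submission
  imports Defs
begin

text \<open>
  Let \<open>m\<close> be a mixture of \<open>q\<close> and \<open>r\<close> with weight \<open>t\<close>, and put \<open>d = q - r\<close>. Then \<open>q = m + t d\<close> and
  \<open>r = m - (1 - t) d\<close>, so expanding \<open>f\<close> to third order at \<open>1\<close> turns the balance equation into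
  \<open>c2/2 (G\<^sup>2 t\<^sup>2 - H\<^sup>2 (1 - t)\<^sup>2) (\<Sum> d\<^sup>2/m) + c3/6 (G\<^sup>2 t\<^sup>3 + H\<^sup>2 (1 - t)\<^sup>3) (\<Sum> d\<^sup>3/m\<^sup>2) = o(\<epsilon>\<^sup>3)\<close>.
  As the first factor is \<open>(G t - H (1 - t)) (G t + H (1 - t))\<close>, this determines \<open>t\<close> up to \<open>o(\<epsilon>)\<close>,
  hence the merged density up to \<open>o(\<epsilon>\<^sup>2)\<close>. The cubic sum vanishes when two leaves are merged, and
  only the second merge contributes. Existence of a balancing weight is the intermediate value
  theorem; uniqueness on all of \<open>[0, 1]\<close> holds because, by convexity of \<open>f\<close>, the left side
  of the balance equation is strictly increasing and the right side decreasing in \<open>t\<close>.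
\<close>

section \<open>Third-order Taylor expansion with Peano remainder\<close>

lemma C_k_on_has_derivative:
  assumes "C_k_on k f U" "open U" "j < k" "x \<in> U"
  shows "((deriv ^^ j) f has_real_derivative (deriv ^^ Suc j) f x) (at x)"
proof -
  have "(deriv ^^ j) f differentiable at x"
    using assms by (auto simp: C_k_on_def differentiable_on_eq_differentiable_at)
  then show ?thesis
    using DERIV_deriv_iff_real_differentiable by auto
qed

text \<open>Lagrange's form evaluates the third derivative at a point within
  \<open>\<bar>v\<bar>\<close> of \<open>c\<close>; continuity of that derivative at
  \<open>c\<close> turns the error into \<open>o(v ^ 3)\<close>.\<close>

lemma C_k_on_3_expansion:
  assumes C: "C_k_on 3 f U" and U: "open U" "c \<in> U" and "f c = 0" "deriv f c = 0"
  shows "((\<lambda>v. (f (c + v) - (deriv ^^ 2) f c / 2 * v\<^sup>2 - (deriv ^^ 3) f c / 6 * v ^ 3) / v ^ 3)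
           \<longlongrightarrow> 0) (at 0)"
proof (rule LIM_I)
  fix r :: real assume "r > 0"
  let ?D = "\<lambda>j. (deriv ^^ j) f"
  have "isCont (?D 3) c"
    using C U by (auto simp: C_k_on_def continuous_on_eq_continuous_at)
  then obtain e1 where e1: "e1 > 0" "\<And>y. dist y c < e1 \<Longrightarrow> dist (?D 3 y) (?D 3 c) < r"
    using \<open>r > 0\<close> unfolding continuous_at_eps_delta by blast
  obtain e2 where e2: "e2 > 0" "ball c e2 \<subseteq> U"
    using U by (auto simp: open_contains_ball)
  define e where "e = min e1 e2"
  have "norm ((f (c + v) - ?D 2 c / 2 * v\<^sup>2 - ?D 3 c / 6 * v ^ 3) / v ^ 3 - 0) < r"
    if v: "v \<noteq> 0" "norm (v - 0) < e" for v
  proof -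
    have D: "\<forall>m x. m < 3 \<and> c - \<bar>v\<bar> \<le> x \<and> x \<le> c + \<bar>v\<bar> \<longrightarrow> DERIV (?D m) x :> ?D (Suc m) x"
      using v e2 by (intro allI impI C_k_on_has_derivative[OF C U(1)]) (auto simp: e_def dist_real_def subset_eq)
    have "\<exists>y. (if c + v < c then c + v < y \<and> y < c else c < y \<and> y < c + v) \<and>
        f (c + v) = (\<Sum>m<3. ?D m c / fact m * (c + v - c) ^ m) + ?D 3 y / fact 3 * (c + v - c) ^ 3"
      by (rule Taylor[of 3 ?D f "c - \<bar>v\<bar>" "c + \<bar>v\<bar>" c "c + v", OF _ _ D]) (use v(1) in auto)
    then obtain y where "if c + v < c then c + v < y \<and> y < c else c < y \<and> y < c + v"
      and y2: "f (c + v) = (\<Sum>m<3. ?D m c / fact m * v ^ m) + ?D 3 y / fact 3 * v ^ 3"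
      by auto
    then have y: "\<bar>y - c\<bar> < \<bar>v\<bar>"
      by (auto split: if_splits)
    have "(\<Sum>m<3. ?D m c / fact m * v ^ m) = ?D 2 c / 2 * v\<^sup>2"
      using assms by (simp add: numeral_3_eq_3 numeral_2_eq_2)
    then have "(f (c + v) - ?D 2 c / 2 * v\<^sup>2 - ?D 3 c / 6 * v ^ 3) / v ^ 3 = (?D 3 y - ?D 3 c) / 6"
      using v y2 by (simp add: field_simps fact_numeral)
    moreover have "\<bar>?D 3 y - ?D 3 c\<bar> < r"
      using e1(2)[of y] y v by (simp add: dist_real_def e_def)
    then have "norm ((?D 3 y - ?D 3 c) / 6) < r"
      using \<open>r > 0\<close> by simp
    ultimately show ?thesis
      by (simp only: diff_zero)
  qed
  then show "\<exists>s>0. \<forall>v. v \<noteq> 0 \<and> norm (v - 0) < s \<longrightarrow>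
      norm ((f (c + v) - ?D 2 c / 2 * v\<^sup>2 - ?D 3 c / 6 * v ^ 3) / v ^ 3 - 0) < r"
    using e1 e2 by (intro exI[of _ e]) (auto simp: e_def)
qed

section \<open>Mixtures and second-order expansions of families of densities\<close>

lemma mixture_nth: "mixture q r t $ x = (1 - t) * q $ x + t * r $ x"
  by (simp add: mixture_def)

lemma mixture_self: "mixture q q t = q"
  by (simp add: mixture_def algebra_simps)

lemma mixture_pos:
  assumes "\<And>x. q $ x > 0" "\<And>x. r $ x > 0" "t \<in> {0..1}"
  shows "mixture q r t $ x > 0"
proof (cases "t = 0")
  case False
  then show ?thesis
    using assms(1)[of x] assms(2)[of x] assms(3) by (auto simp: mixture_nth intro!: add_nonneg_pos)
qed (use assms in \<open>simp add: mixture_nth\<close>)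

text \<open>Lies behind monotonicity in the weight: the nearer of two points on the segment is
  itself a mixture of the endpoint and the farther point, so one convexity estimate compares the two
  divergences. The next lemma is the mirror image, seen from \<open>r\<close>.\<close>

lemma mixture_restart_left:
  assumes "s < s'" "0 \<le> s"
  shows "mixture q r s = mixture q (mixture q r s') (s / s')"
  using assms by (simp add: vec_eq_iff mixture_nth field_simps)

lemma mixture_restart_right:
  assumes "s < s'" "s' \<le> 1"
  shows "mixture q r s' = mixture r (mixture q r s) ((1 - s') / (1 - s))"
proof -
  have "1 - s \<noteq> 0" using assms by auto
  then show ?thesis
    by (simp add: vec_eq_iff mixture_nth divide_simps) (simp add: algebra_simps)
qed

lemma tendsto_of_quotient:
  fixes q :: "real \<Rightarrow> 'a :: real_normed_vector"
  assumes "((\<lambda>\<epsilon>. (q \<epsilon> - p) /\<^sub>R \<epsilon>) \<longlongrightarrow> a) (at 0)"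
  shows "(q \<longlongrightarrow> p) (at 0)"
proof -
  have "((\<lambda>\<epsilon>. p + \<epsilon> *\<^sub>R ((q \<epsilon> - p) /\<^sub>R \<epsilon>)) \<longlongrightarrow> p + 0 *\<^sub>R a) (at 0)"
    by (intro tendsto_intros assms)
  then have "((\<lambda>\<epsilon>. p + \<epsilon> *\<^sub>R ((q \<epsilon> - p) /\<^sub>R \<epsilon>)) \<longlongrightarrow> p) (at 0)"
    by simp
  then show ?thesis
    by (rule Lim_transform_eventually) (simp add: eventually_at_filter)
qed

text \<open>Peano-type expansion \<open>q \<epsilon> = p + \<epsilon> a + \<epsilon>\<^sup>2 a' +
  o(\<epsilon>\<^sup>2)\<close>, with no factor 1/2 on \<open>a'\<close>. It asks for no regularity
  away from \<open>0\<close>, where balancing weights are not controlled.\<close>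

definition expands_to_second_order ::
  "(real \<Rightarrow> 'a :: real_normed_vector) \<Rightarrow> 'a \<Rightarrow> 'a \<Rightarrow> 'a \<Rightarrow> bool" where
  "expands_to_second_order q p a a' \<longleftrightarrow> ((\<lambda>\<epsilon>. (q \<epsilon> - p - \<epsilon> *\<^sub>R a) /\<^sub>R \<epsilon>\<^sup>2) \<longlongrightarrow> a') (at 0)"

lemma expands_to_second_order_affine: "expands_to_second_order (\<lambda>\<epsilon>. p + \<epsilon> *\<^sub>R a) p a 0"
  by (simp add: expands_to_second_order_def)

lemma expands_to_second_order_first:
  assumes "expands_to_second_order q p a a'"
  shows "((\<lambda>\<epsilon>. (q \<epsilon> - p) /\<^sub>R \<epsilon>) \<longlongrightarrow> a) (at 0)"
proof -
  have "((\<lambda>\<epsilon>. a + \<epsilon> *\<^sub>R ((q \<epsilon> - p - \<epsilon> *\<^sub>R a) /\<^sub>R \<epsilon>\<^sup>2)) \<longlongrightarrow> a + 0 *\<^sub>R a') (at 0)"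
    using assms unfolding expands_to_second_order_def by (intro tendsto_intros)
  then have "((\<lambda>\<epsilon>. a + \<epsilon> *\<^sub>R ((q \<epsilon> - p - \<epsilon> *\<^sub>R a) /\<^sub>R \<epsilon>\<^sup>2)) \<longlongrightarrow> a) (at 0)"
    by simp
  then show ?thesis
  proof (rule Lim_transform_eventually)
    have "a + \<epsilon> *\<^sub>R ((q \<epsilon> - p - \<epsilon> *\<^sub>R a) /\<^sub>R \<epsilon>\<^sup>2) = (q \<epsilon> - p) /\<^sub>R \<epsilon>" if "\<epsilon> \<noteq> 0" for \<epsilon>
    proof -
      have "\<epsilon> * inverse (\<epsilon>\<^sup>2) = inverse \<epsilon>"
        using that by (simp add: power2_eq_square)
      then show ?thesis
        unfolding scaleR_scaleR using that by (simp add: scaleR_diff_right)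
    qed
    then show "\<forall>\<^sub>F \<epsilon> in at 0. a + \<epsilon> *\<^sub>R ((q \<epsilon> - p - \<epsilon> *\<^sub>R a) /\<^sub>R \<epsilon>\<^sup>2) = (q \<epsilon> - p) /\<^sub>R \<epsilon>"
      by (simp add: eventually_at_filter)
  qed
qed

text \<open>Both families start at the same \<open>p\<close>, so they differ only at order
  \<epsilon>; a first-order change of the weight therefore enters at second order, along
  \<open>b - a\<close>.\<close>

lemma mixture_expands_to_second_order:
  assumes q: "expands_to_second_order q p a a'" and r: "expands_to_second_order r p b b'"
    and t: "((\<lambda>\<epsilon>. (t \<epsilon> - s) / \<epsilon>) \<longlongrightarrow> \<tau>) (at 0)"
  shows "expands_to_second_order (\<lambda>\<epsilon>. mixture (q \<epsilon>) (r \<epsilon>) (t \<epsilon>)) p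
    (mixture a b s) (mixture a' b' s + \<tau> *\<^sub>R (b - a))"
proof -
  have "((\<lambda>\<epsilon>. (t \<epsilon> - s) /\<^sub>R \<epsilon>) \<longlongrightarrow> \<tau>) (at 0)"
    using t by (simp add: divide_inverse mult.commute)
  from tendsto_of_quotient[OF this] have "(t \<longlongrightarrow> s) (at 0)" .
  then have "((\<lambda>\<epsilon>. mixture ((q \<epsilon> - p - \<epsilon> *\<^sub>R a) /\<^sub>R \<epsilon>\<^sup>2) ((r \<epsilon> - p - \<epsilon> *\<^sub>R b) /\<^sub>R \<epsilon>\<^sup>2) (t \<epsilon>) +
      ((t \<epsilon> - s) / \<epsilon>) *\<^sub>R (b - a)) \<longlongrightarrow> mixture a' b' s + \<tau> *\<^sub>R (b - a)) (at 0)"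
    using q r t unfolding expands_to_second_order_def mixture_def by (intro tendsto_intros)
  then show ?thesis
    unfolding expands_to_second_order_def
  proof (rule Lim_transform_eventually)
    have "mixture ((q \<epsilon> - p - \<epsilon> *\<^sub>R a) /\<^sub>R \<epsilon>\<^sup>2) ((r \<epsilon> - p - \<epsilon> *\<^sub>R b) /\<^sub>R \<epsilon>\<^sup>2) (t \<epsilon>) +
      ((t \<epsilon> - s) / \<epsilon>) *\<^sub>R (b - a) =
      (mixture (q \<epsilon>) (r \<epsilon>) (t \<epsilon>) - p - \<epsilon> *\<^sub>R mixture a b s) /\<^sub>R \<epsilon>\<^sup>2" if "\<epsilon> \<noteq> 0" for \<epsilon>
      using that by (simp add: vec_eq_iff mixture_nth divide_simps power2_eq_square) (simp add: algebra_simps)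
    then show "\<forall>\<^sub>F \<epsilon> in at 0. mixture ((q \<epsilon> - p - \<epsilon> *\<^sub>R a) /\<^sub>R \<epsilon>\<^sup>2) ((r \<epsilon> - p - \<epsilon> *\<^sub>R b) /\<^sub>R \<epsilon>\<^sup>2) (t \<epsilon>) +
      ((t \<epsilon> - s) / \<epsilon>) *\<^sub>R (b - a) =
      (mixture (q \<epsilon>) (r \<epsilon>) (t \<epsilon>) - p - \<epsilon> *\<^sub>R mixture a b s) /\<^sub>R \<epsilon>\<^sup>2"
      by (simp add: eventually_at_filter)
  qed
qed

text \<open>The difference of the two sides of the balance equation, with \<open>e = c2 / 2\<close>,
  \<open>P\<close> the quadratic sum and \<open>N\<close>, \<open>M\<close> the cubic sums. The
  difference of squares is factored to isolate the factor that vanishes at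
  \<open>t = H / (G + H)\<close>.\<close>

lemma cubic_balance_identity:
  fixes e P G H t \<epsilon> N M :: real
  shows "G\<^sup>2 * ((t * \<epsilon>)\<^sup>2 * (e * P + t * \<epsilon> * N)) - H\<^sup>2 * ((- (1 - t) * \<epsilon>)\<^sup>2 * (e * P + - (1 - t) * \<epsilon> * M)) =
    \<epsilon>\<^sup>2 * ((G * t - H * (1 - t)) * ((G * t + H * (1 - t)) * e * P) + \<epsilon> * (G\<^sup>2 * t ^ 3 * N + H\<^sup>2 * (1 - t) ^ 3 * M))"
  by algebra

section \<open>Positivity of the divergence; existence and uniqueness of balancing weights\<close>

text \<open>\<open>c2\<close> and \<open>c3\<close> play the roles of f''(1) and f'''(1); smoothness
  enters only through the expansion.\<close>

locale divergence_generator =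
  fixes f :: "real \<Rightarrow> real" and c2 c3 :: real
  assumes convex: "convex_on {0<..} f"
    and f_1: "f 1 = 0"
    and c2_pos: "c2 > 0"
    and expansion: "((\<lambda>v. (f (1 + v) - c2 / 2 * v\<^sup>2 - c3 / 6 * v ^ 3) / v ^ 3) \<longlongrightarrow> 0) (at 0)"
begin

definition remainder :: "real \<Rightarrow> real" where
  "remainder v = (f (1 + v) - c2 / 2 * v\<^sup>2 - c3 / 6 * v ^ 3) / v ^ 3"

lemma remainder_0: "remainder 0 = 0"
  by (simp add: remainder_def)

text \<open>Since division by zero gives \<open>0\<close>, \<open>remainder 0\<close> has the right value for continuity at \<open>0\<close>.\<close>

lemma isCont_remainder: "isCont remainder 0"
  using expansion unfolding isCont_def remainder_0 by (simp only: remainder_def[abs_def])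

text \<open>An exact identity for every \<open>v\<close>, so that the algebra of the balance
  equation can be done before any limit is taken.\<close>

lemma f_expansion: "f (1 + v) = v\<^sup>2 * (c2 / 2 + v * (c3 / 6 + remainder v))"
  using f_1 by (cases "v = 0") (auto simp: remainder_def field_simps power2_eq_square power3_eq_cube)

text \<open>Near \<open>1\<close> the quadratic term dominates, so \<open>f\<close> is positive at
  some point \<open>1 + l (y - 1)\<close> with \<open>0 < l < 1\<close>; convexity and
  \<open>f 1 = 0\<close> bound that value by \<open>l * f y\<close>.\<close>

lemma f_pos:
  assumes "y > 0" "y \<noteq> 1"
  shows "f y > 0"
proof -
  have "((\<lambda>l::real. c2 / 2 + l * (y - 1) * (c3 / 6 + remainder (l * (y - 1)))) \<longlongrightarrow>
      c2 / 2 + 0 * (y - 1) * (c3 / 6 + remainder 0)) (at_right 0)"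
    by (intro tendsto_intros isCont_tendsto_compose[OF isCont_remainder] tendsto_eq_intros) auto
  from order_tendstoD(1)[OF this, of 0]
  have "\<forall>\<^sub>F l in at_right 0. c2 / 2 + l * (y - 1) * (c3 / 6 + remainder (l * (y - 1))) > 0"
    using c2_pos by simp
  moreover have "\<forall>\<^sub>F l in at_right 0. l \<in> {0<..<1::real}"
    by (intro eventually_at_right_real) auto
  ultimately have "\<forall>\<^sub>F l in at_right 0. l \<in> {0<..<1} \<and>
      c2 / 2 + l * (y - 1) * (c3 / 6 + remainder (l * (y - 1))) > 0"
    by eventually_elim auto
  then obtain l where l: "l \<in> {0<..<1}" "c2 / 2 + l * (y - 1) * (c3 / 6 + remainder (l * (y - 1))) > 0"
    using eventually_happens trivial_limit_at_right_real by blast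
  have "0 < (l * (y - 1))\<^sup>2 * (c2 / 2 + l * (y - 1) * (c3 / 6 + remainder (l * (y - 1))))"
    using l assms by (intro mult_pos_pos) auto
  also have "\<dots> = f (1 + l * (y - 1))"
    by (rule f_expansion[symmetric])
  also have "1 + l * (y - 1) = (1 - l) * 1 + l * y"
    by (simp add: algebra_simps)
  also have "f \<dots> \<le> (1 - l) * f 1 + l * f y"
    using convex_onD[OF convex, of l 1 y] l assms by auto
  finally show ?thesis
    using l f_1 by (simp add: zero_less_mult_iff)
qed

lemma f_nonneg: "y > 0 \<Longrightarrow> f y \<ge> 0"
  using f_pos[of y] f_1 by fastforce

lemma f_divergence_nonneg:
  assumes "\<And>x. q $ x > 0" "\<And>x. r $ x > 0"
  shows "f_divergence f r q \<ge> 0"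
  unfolding f_divergence_def using assms by (intro sum_nonneg mult_nonneg_nonneg f_nonneg) (auto simp: less_imp_le)

lemma f_divergence_pos:
  assumes "\<And>x. q $ x > 0" "\<And>x. r $ x > 0" "q \<noteq> r"
  shows "f_divergence f r q > 0"
proof -
  obtain x where "q $ x \<noteq> r $ x"
    using assms(3) by (auto simp: vec_eq_iff)
  then have "r $ x / q $ x \<noteq> 1"
    using assms(1)[of x] by (simp add: field_simps)
  then show ?thesis
    unfolding f_divergence_def using assms(1,2)
    by (intro sum_pos2[of _ x] mult_pos_pos mult_nonneg_nonneg f_nonneg f_pos) (auto simp: less_imp_le)
qed

text \<open>The density ratio of \<open>q\<close> to the mixture is a convex combination of \<open>1\<close> and the ratio of \<open>q\<close> to \<open>m\<close>.\<close>

lemma f_divergence_mixture_le: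
  assumes q: "\<And>x. q $ x > 0" and m: "\<And>x. m $ x > 0" and l: "l \<in> {0..1}"
  shows "f_divergence f q (mixture q m l) \<le> l * f_divergence f q m"
  unfolding f_divergence_def sum_distrib_left
proof (rule sum_mono)
  fix x
  define M where "M = mixture q m l $ x"
  have M: "M > 0" "M = (1 - l) * q $ x + l * m $ x"
    using mixture_pos[OF q m l] by (auto simp: M_def mixture_nth)
  \<comment> \<open>The share of \<open>m\<close> in the mixture at \<open>x\<close>. It is the
    weight that writes \<open>q $ x / M\<close> as a combination of \<open>1\<close> and
    \<open>q $ x / m $ x\<close>, and \<open>M * k = l * m $ x\<close> restores the weight of the
    sum.\<close>
  define k where "k = l * m $ x / M"
  have "0 \<le> (1 - l) * q $ x"
    using l q[of x] by auto
  then have k: "0 \<le> k" "k \<le> 1" "1 - k = (1 - l) * q $ x / M"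
    using M l m[of x] by (auto simp: k_def field_simps)
  have "(1 - k) *\<^sub>R 1 + k *\<^sub>R (q $ x / m $ x) = q $ x / M"
    unfolding k(3) using M(1) m[of x] q[of x] by (simp add: k_def field_simps)
  then have "f (q $ x / M) \<le> (1 - k) * f 1 + k * f (q $ x / m $ x)"
    using convex_onD[OF convex, of k 1 "q $ x / m $ x"] k q[of x] m[of x] by auto
  then have "M * f (q $ x / M) \<le> M * (k * f (q $ x / m $ x))"
    using M(1) f_1 by (intro mult_left_mono) auto
  also have "\<dots> = l * (m $ x * f (q $ x / m $ x))"
    using M(1) by (simp add: k_def)
  finally show "mixture q m l $ x * f (q $ x / mixture q m l $ x) \<le> l * (m $ x * f (q $ x / m $ x))"
    by (simp add: M_def)
qed

text \<open>Passing from \<open>s\<close> to \<open>s'\<close> strictly raises the divergence of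
  \<open>q\<close> and does not raise that of \<open>r\<close>; both follow from
  \<open>f_divergence_mixture_le\<close> after restarting the segment at the respective
  endpoint.\<close>

lemma balances_unique_less:
  assumes q: "\<And>x. q $ x > 0" and r: "\<And>x. r $ x > 0" and "q \<noteq> r" and G: "G > 0" "H > 0"
    and s: "balances f G q H r s" and s': "balances f G q H r s'" and "s < s'"
  shows False
proof -
  let ?D = "\<lambda>v t. f_divergence f v (mixture q r t)"
  have I: "s \<in> {0..1}" "s' \<in> {0..1}"
    using s s' by (auto simp: balances_def)
  have pos: "mixture q r s $ x > 0" "mixture q r s' $ x > 0" for x
    using mixture_pos[OF q r] I by auto
  have "?D q s \<le> s / s' * ?D q s'"
    using f_divergence_mixture_le[OF q pos(2), of "s / s'"] mixture_restart_left[OF \<open>s < s'\<close>, of q r] I \<open>s < s'\<close> by auto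
  \<comment> \<open>Strictness: \<open>s / s' < 1\<close>, and the divergence at \<open>s'\<close>
    is positive because the mixture differs from \<open>q\<close> by a nonzero multiple of
    \<open>r - q\<close>.\<close>
  also have "\<dots> < 1 * ?D q s'"
  proof (rule mult_strict_right_mono)
    have "mixture q r s' - q = s' *\<^sub>R (r - q)"
      by (simp add: mixture_def algebra_simps)
    then have "mixture q r s' \<noteq> q"
      using \<open>q \<noteq> r\<close> I \<open>s < s'\<close> by auto
    then show "0 < ?D q s'"
      using f_divergence_pos[OF pos(2) q] by simp
  qed (use I \<open>s < s'\<close> in auto)
  finally have "G\<^sup>2 * ?D q s < G\<^sup>2 * ?D q s'"
    using G by simp
  moreover have "?D r s' \<le> (1 - s') / (1 - s) * ?D r s"
    using f_divergence_mixture_le[OF r pos(1), of "(1 - s') / (1 - s)"] mixture_restart_right[OF \<open>s < s'\<close>, of q r] I \<open>s < s'\<close> by auto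
  moreover have "(1 - s') / (1 - s) * ?D r s \<le> 1 * ?D r s"
    using f_divergence_nonneg[OF pos(1) r] I \<open>s < s'\<close> by (intro mult_right_mono) auto
  ultimately have "G\<^sup>2 * ?D q s < G\<^sup>2 * ?D q s'" "H\<^sup>2 * ?D r s' \<le> H\<^sup>2 * ?D r s"
    using G by auto
  then show False
    using s s' by (simp add: balances_def)
qed

lemma balances_unique:
  assumes "\<And>x. q $ x > 0" "\<And>x. r $ x > 0" "q \<noteq> r" "G > 0" "H > 0"
    and "balances f G q H r s" "balances f G q H r s'"
  shows "s = s'"
  using balances_unique_less[OF assms(1-5)] assms(6,7) linorder_neqE_linordered_idom by metis

text \<open>At weight \<open>0\<close> the mixture is \<open>q\<close> and the left side vanishes;
  at weight \<open>1\<close> it is \<open>r\<close> and the right side vanishes. Convexity on the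
  open half-line makes \<open>f\<close> continuous, hence also both sides.\<close>

lemma balances_exists:
  fixes q r :: "real ^ 'n"
  assumes q: "\<And>x. q $ x > 0" and r: "\<And>x. r $ x > 0"
  shows "\<exists>s. balances f G q H r s"
proof -
  let ?D = "\<lambda>v t. f_divergence f v (mixture q r t)"
  have f_cont: "continuous_on {0<..} f"
    using convex_on_continuous[OF _ convex] by simp
  have cont: "continuous_on {0..1} (?D v)" if "\<And>x. v $ x > 0" for v
  proof -
    have "continuous_on {0..1} (\<lambda>t. mixture q r t $ x)" for x
      unfolding mixture_nth by (intro continuous_intros)
    moreover have "mixture q r t $ x \<noteq> 0" "v $ x / mixture q r t $ x > 0" if "t \<in> {0..1}" for t x
      using mixture_pos[OF q r that, of x] \<open>v $ x > 0\<close> by auto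
    ultimately show ?thesis
      unfolding f_divergence_def
      by (intro continuous_on_sum continuous_on_mult continuous_on_compose2[OF f_cont]
          continuous_on_divide continuous_on_const) auto
  qed
  have "\<exists>t\<ge>0. t \<le> 1 \<and> G\<^sup>2 * ?D q t - H\<^sup>2 * ?D r t = 0"
  proof (rule IVT')
    have "mixture q r 0 = q" "mixture q r 1 = r"
      by (simp_all add: mixture_def)
    moreover have "f_divergence f v v = 0" if "\<And>x. v $ x > 0" for v :: "real ^ 'n"
      using that f_1 by (simp add: f_divergence_def less_imp_neq[symmetric])
    ultimately show "G\<^sup>2 * ?D q 0 - H\<^sup>2 * ?D r 0 \<le> 0" "0 \<le> G\<^sup>2 * ?D q 1 - H\<^sup>2 * ?D r 1"
      using f_divergence_nonneg[OF q r] f_divergence_nonneg[OF r q] q r by auto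
    show "continuous_on {0..1} (\<lambda>t. G\<^sup>2 * ?D q t - H\<^sup>2 * ?D r t)"
      using cont q r by (intro continuous_intros) auto
  qed auto
  then show ?thesis
    by (auto simp: balances_def)
qed

section \<open>First-order expansion of the balancing weight\<close>

text \<open>The coefficient of \<epsilon> in the balancing weight: the cubic part of the balance
  equation divided by the quadratic one. \<open>d\<close> is the difference of the first-order terms
  of the two densities.\<close>

definition weight_slope :: "real \<Rightarrow> real \<Rightarrow> real ^ 'n \<Rightarrow> real ^ 'n \<Rightarrow> real" where
  "weight_slope G H p d =
     - c3 / (6 * c2) * (G * H / (G + H)\<^sup>2) * ((\<Sum>x\<in>UNIV. d $ x ^ 3 / (p $ x)\<^sup>2) / (\<Sum>x\<in>UNIV. (d $ x)\<^sup>2 / p $ x))"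

text \<open>The scale \<open>v\<close> is kept apart from the direction \<open>u\<close> so that
  both divergences of a merge share one \<open>u\<close>: \<open>v\<close> is
  \<open>t \<epsilon>\<close> for the left density and \<open>- (1 - t) \<epsilon>\<close> for the
  right one.\<close>

lemma f_divergence_expansion:
  assumes "\<And>x. q $ x = m $ x * (1 + v * u x)" "\<And>x. m $ x \<noteq> 0"
  shows "f_divergence f q m =
    v\<^sup>2 * (c2 / 2 * (\<Sum>x\<in>UNIV. m $ x * (u x)\<^sup>2) +
      v * (\<Sum>x\<in>UNIV. m $ x * u x ^ 3 * (c3 / 6 + remainder (v * u x))))"
proof -
  have "f_divergence f q m =
      (\<Sum>x\<in>UNIV. v\<^sup>2 * (c2 / 2 * (m $ x * (u x)\<^sup>2) + v * (m $ x * u x ^ 3 * (c3 / 6 + remainder (v * u x)))))"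
    unfolding f_divergence_def
  proof (rule sum.cong[OF refl])
    fix x
    have "q $ x / m $ x = 1 + v * u x"
      using assms by simp
    then show "m $ x * f (q $ x / m $ x) =
        v\<^sup>2 * (c2 / 2 * (m $ x * (u x)\<^sup>2) + v * (m $ x * u x ^ 3 * (c3 / 6 + remainder (v * u x))))"
      by (simp only: f_expansion) (simp add: power2_eq_square power3_eq_cube algebra_simps)
  qed
  then show ?thesis
    by (simp only: sum.distrib sum_distrib_left[symmetric])
qed

text \<open>Convergence of \<open>t\<close> is a conclusion here, not an assumption. The balance
  equation is solved exactly for \<open>t - H / (G + H)\<close>; the bound
  \<open>0 \<le> t \<le> 1\<close> alone shows that this tends to \<open>0\<close>, and only then
  can the limit of its quotient by \<epsilon> be computed.\<close>

lemma balancing_weight_slope: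
  fixes q r :: "real \<Rightarrow> real ^ 'n" and p a b :: "real ^ 'n"
  assumes q: "((\<lambda>\<epsilon>. (q \<epsilon> - p) /\<^sub>R \<epsilon>) \<longlongrightarrow> a) (at 0)"
    and r: "((\<lambda>\<epsilon>. (r \<epsilon> - p) /\<^sub>R \<epsilon>) \<longlongrightarrow> b) (at 0)"
    and p: "\<And>x. p $ x > 0" and ab: "a \<noteq> b" and G: "G > 0" and H: "H > 0"
    and bal: "\<forall>\<^sub>F \<epsilon> in at 0. balances f G (q \<epsilon>) H (r \<epsilon>) (t \<epsilon>)"
  shows "((\<lambda>\<epsilon>. (t \<epsilon> - H / (G + H)) / \<epsilon>) \<longlongrightarrow> weight_slope G H p (a - b)) (at 0)"
proof -
  define m where "m \<epsilon> = mixture (q \<epsilon>) (r \<epsilon>) (t \<epsilon>)" for \<epsilon>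
  define u where "u \<epsilon> x = (q \<epsilon> $ x - r \<epsilon> $ x) / \<epsilon> / m \<epsilon> $ x" for \<epsilon> x
  define s where "s = H / (G + H)"
  \<comment> \<open>\<open>S 2\<close> and \<open>S 3\<close> are the denominator and the numerator
    of the quotient in \<open>weight_slope\<close>.\<close>
  define S where "S k = (\<Sum>x\<in>UNIV. p $ x * ((a - b) $ x / p $ x) ^ k)" for k
  have t01: "\<forall>\<^sub>F \<epsilon> in at 0. t \<epsilon> \<in> {0..1}"
    using bal by eventually_elim (simp add: balances_def)
  have ne: "\<forall>\<^sub>F \<epsilon> in at (0::real). \<epsilon> \<noteq> 0"
    by (simp add: eventually_at_filter)
  have "((\<lambda>\<epsilon>. r \<epsilon> - q \<epsilon>) \<longlongrightarrow> 0) (at 0)"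
    using tendsto_diff[OF tendsto_of_quotient[OF r] tendsto_of_quotient[OF q]] by simp
  then have "((\<lambda>\<epsilon>. norm (r \<epsilon> - q \<epsilon>)) \<longlongrightarrow> 0) (at 0)"
    by (rule tendsto_norm_zero)
  \<comment> \<open>Boundedness of \<open>t\<close> suffices for the mixture to tend to
    \<open>p\<close>.\<close>
  then have "((\<lambda>\<epsilon>. t \<epsilon> *\<^sub>R (r \<epsilon> - q \<epsilon>)) \<longlongrightarrow> 0) (at 0)"
    by (rule Lim_null_comparison[rotated])
      (use t01 in eventually_elim, auto simp: mult_left_le_one_le)
  from tendsto_add[OF tendsto_of_quotient[OF q] this] have "(m \<longlongrightarrow> p) (at 0)"
    by (simp add: m_def[abs_def] mixture_def algebra_simps)
  then have m: "((\<lambda>\<epsilon>. m \<epsilon> $ x) \<longlongrightarrow> p $ x) (at 0)" for x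
    by (rule tendsto_vec_nth)
  have "((\<lambda>\<epsilon>. (q \<epsilon> $ x - r \<epsilon> $ x) / \<epsilon>) \<longlongrightarrow> (a - b) $ x) (at 0)" for x
    using tendsto_vec_nth[OF tendsto_diff[OF q r], of x] by (simp add: algebra_simps divide_inverse)
  then have u: "((\<lambda>\<epsilon>. u \<epsilon> x) \<longlongrightarrow> (a - b) $ x / p $ x) (at 0)" for x
    unfolding u_def using p[of x] by (intro tendsto_divide m) auto
  have eu: "((\<lambda>\<epsilon>. norm (\<epsilon> * u \<epsilon> x)) \<longlongrightarrow> 0) (at 0)" for x
    using tendsto_norm[OF tendsto_mult[OF tendsto_ident_at u[of x]]] by simp
  \<comment> \<open>Stated for any factor bounded by \<open>1\<close>, to cover both
    \<open>t\<close> and \<open>- (1 - t)\<close>.\<close>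
  have rem: "((\<lambda>\<epsilon>. remainder (v \<epsilon> * \<epsilon> * u \<epsilon> x)) \<longlongrightarrow> 0) (at 0)"
    if "\<forall>\<^sub>F \<epsilon> in at 0. \<bar>v \<epsilon>\<bar> \<le> 1" for v x
  proof -
    have "((\<lambda>\<epsilon>. v \<epsilon> * \<epsilon> * u \<epsilon> x) \<longlongrightarrow> 0) (at 0)"
      using eu[of x] by (rule Lim_null_comparison[rotated])
        (use that in eventually_elim, auto simp: abs_mult mult.assoc mult_left_le_one_le)
    from isCont_tendsto_compose[OF isCont_remainder this] show ?thesis
      by (simp add: remainder_0)
  qed
  define P where "P \<epsilon> = (\<Sum>x\<in>UNIV. m \<epsilon> $ x * (u \<epsilon> x)\<^sup>2)" for \<epsilon>
  define N where "N v \<epsilon> = (\<Sum>x\<in>UNIV. m \<epsilon> $ x * u \<epsilon> x ^ 3 * (c3 / 6 + remainder (v \<epsilon> * \<epsilon> * u \<epsilon> x)))" for v \<epsilon>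
  define N1 where "N1 = N t"
  define N2 where "N2 = N (\<lambda>\<epsilon>. - (1 - t \<epsilon>))"
  have P: "(P \<longlongrightarrow> S 2) (at 0)"
    unfolding P_def S_def by (intro tendsto_intros m u)
  have N: "(N v \<longlongrightarrow> S 3 * (c3 / 6 + 0)) (at 0)" if "\<forall>\<^sub>F \<epsilon> in at 0. \<bar>v \<epsilon>\<bar> \<le> 1" for v
    unfolding N_def S_def sum_distrib_right by (intro tendsto_intros m u rem that)
  have N1: "(N1 \<longlongrightarrow> S 3 * (c3 / 6)) (at 0)"
    using N[of t] t01 by (simp add: N1_def eventually_mono)
  have N2: "(N2 \<longlongrightarrow> S 3 * (c3 / 6)) (at 0)"
    using N[of "\<lambda>\<epsilon>. - (1 - t \<epsilon>)"] t01 by (simp add: N2_def eventually_mono)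
  have "\<exists>x. (a - b) $ x \<noteq> 0"
    using ab by (auto simp: vec_eq_iff)
  then obtain x0 where "(a - b) $ x0 \<noteq> 0" by blast
  then have S2: "S 2 > 0"
    unfolding S_def using p by (intro sum_pos2[of _ x0] mult_pos_pos mult_nonneg_nonneg)
      (auto simp: less_imp_le less_imp_neq[symmetric])
  have pos: "\<forall>\<^sub>F \<epsilon> in at 0. P \<epsilon> > 0"
    using order_tendstoD(1)[OF P S2] .
  have mne: "\<forall>\<^sub>F \<epsilon> in at 0. \<forall>x. m \<epsilon> $ x \<noteq> 0"
    using p by (intro eventually_all_finite tendsto_imp_eventually_ne[OF m]) (auto simp: less_imp_neq[symmetric])
  \<comment> \<open>\<open>R\<close> is the cubic part. \<open>L\<close> is what multiplies
    \<open>(t - s) P\<close> in the quadratic part, since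
    \<open>G t - H (1 - t) = (t - s) (G + H)\<close>.\<close>
  define R where "R \<epsilon> = G\<^sup>2 * t \<epsilon> ^ 3 * N1 \<epsilon> + H\<^sup>2 * (1 - t \<epsilon>) ^ 3 * N2 \<epsilon>" for \<epsilon>
  define L where "L \<epsilon> = (G + H) * (G * t \<epsilon> + H * (1 - t \<epsilon>)) * (c2 / 2)" for \<epsilon>
  \<comment> \<open>\<open>G t + H (1 - t)\<close> is an average of \<open>G\<close> and
    \<open>H\<close>, so \<open>L\<close> stays away from zero wherever \<open>t\<close> lies in
    \<open>[0, 1]\<close>.\<close>
  have Lge: "\<forall>\<^sub>F \<epsilon> in at 0. L \<epsilon> \<ge> (G + H) * min G H * (c2 / 2)"
    using t01
  proof eventually_elim
    case (elim \<epsilon>)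
    have "min G H * t \<epsilon> + min G H * (1 - t \<epsilon>) \<le> G * t \<epsilon> + H * (1 - t \<epsilon>)"
      using elim by (intro add_mono mult_right_mono) auto
    then show ?case
      unfolding L_def using G H c2_pos by (intro mult_right_mono mult_left_mono) (auto simp: algebra_simps)
  qed
  have Lpos: "(G + H) * min G H * (c2 / 2) > 0"
    using G H c2_pos by auto
  have eq: "\<forall>\<^sub>F \<epsilon> in at 0. t \<epsilon> - s = - \<epsilon> * R \<epsilon> / (L \<epsilon> * P \<epsilon>)"
    using bal ne mne pos Lge
  proof eventually_elim
    case (elim \<epsilon>)
    \<comment> \<open>The choice \<open>v = t\<close> gives back \<open>q\<close>, and
      \<open>v = - (1 - t)\<close> gives back \<open>r\<close>.\<close>
    have "m \<epsilon> $ x * (1 + v * \<epsilon> * u \<epsilon> x) = m \<epsilon> $ x + v * (q \<epsilon> $ x - r \<epsilon> $ x)" for v x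
    proof -
      have "m \<epsilon> $ x * (1 + v * \<epsilon> * u \<epsilon> x) = m \<epsilon> $ x + v * (m \<epsilon> $ x * u \<epsilon> x * \<epsilon>)"
        by (simp add: algebra_simps)
      also have "m \<epsilon> $ x * u \<epsilon> x * \<epsilon> = q \<epsilon> $ x - r \<epsilon> $ x"
        using elim by (simp add: u_def)
      finally show ?thesis .
    qed
    then have "q \<epsilon> $ x = m \<epsilon> $ x * (1 + t \<epsilon> * \<epsilon> * u \<epsilon> x)"
      "r \<epsilon> $ x = m \<epsilon> $ x * (1 + - (1 - t \<epsilon>) * \<epsilon> * u \<epsilon> x)" for x
      by (simp_all only:) (simp_all add: m_def mixture_nth algebra_simps)
    then have "f_divergence f (q \<epsilon>) (m \<epsilon>) = (t \<epsilon> * \<epsilon>)\<^sup>2 * (c2 / 2 * P \<epsilon> + t \<epsilon> * \<epsilon> * N1 \<epsilon>)"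
      "f_divergence f (r \<epsilon>) (m \<epsilon>) = (- (1 - t \<epsilon>) * \<epsilon>)\<^sup>2 * (c2 / 2 * P \<epsilon> + - (1 - t \<epsilon>) * \<epsilon> * N2 \<epsilon>)"
      using elim unfolding P_def N1_def N2_def N_def by (intro f_divergence_expansion; blast)+
    then have "G\<^sup>2 * ((t \<epsilon> * \<epsilon>)\<^sup>2 * (c2 / 2 * P \<epsilon> + t \<epsilon> * \<epsilon> * N1 \<epsilon>)) =
      H\<^sup>2 * ((- (1 - t \<epsilon>) * \<epsilon>)\<^sup>2 * (c2 / 2 * P \<epsilon> + - (1 - t \<epsilon>) * \<epsilon> * N2 \<epsilon>))"
      using elim(1) by (simp only: balances_def m_def)
    then have "\<epsilon>\<^sup>2 * ((G * t \<epsilon> - H * (1 - t \<epsilon>)) * ((G * t \<epsilon> + H * (1 - t \<epsilon>)) * (c2 / 2) * P \<epsilon>) + \<epsilon> * R \<epsilon>) = 0"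
      unfolding R_def cubic_balance_identity[symmetric] by (simp only: right_minus_eq)
    then have "(G * t \<epsilon> - H * (1 - t \<epsilon>)) * ((G * t \<epsilon> + H * (1 - t \<epsilon>)) * (c2 / 2) * P \<epsilon>) + \<epsilon> * R \<epsilon> = 0"
      using elim(2) by (simp only: mult_eq_0_iff power_eq_0_iff) simp
    moreover have "G * t \<epsilon> - H * (1 - t \<epsilon>) = (t \<epsilon> - s) * (G + H)"
      using G H by (simp add: s_def field_simps)
    then have "(G * t \<epsilon> - H * (1 - t \<epsilon>)) * ((G * t \<epsilon> + H * (1 - t \<epsilon>)) * (c2 / 2) * P \<epsilon>) =
        (t \<epsilon> - s) * (L \<epsilon> * P \<epsilon>)"
      unfolding L_def by (simp only: mult.assoc)
    ultimately have "(t \<epsilon> - s) * (L \<epsilon> * P \<epsilon>) = - \<epsilon> * R \<epsilon>"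
      by linarith
    moreover have "L \<epsilon> * P \<epsilon> \<noteq> 0"
      using elim(4,5) Lpos by auto
    ultimately show ?case
      by (intro eq_divide_imp)
  qed
  have "((\<lambda>\<epsilon>. \<bar>\<epsilon>\<bar> * (G\<^sup>2 * \<bar>N1 \<epsilon>\<bar> + H\<^sup>2 * \<bar>N2 \<epsilon>\<bar>) / ((G + H) * min G H * (c2 / 2) * P \<epsilon>)) \<longlongrightarrow>
      \<bar>0\<bar> * (G\<^sup>2 * \<bar>S 3 * (c3 / 6)\<bar> + H\<^sup>2 * \<bar>S 3 * (c3 / 6)\<bar>) / ((G + H) * min G H * (c2 / 2) * S 2)) (at 0)"
    using Lpos S2 by (intro tendsto_intros N1 N2 P) auto
  then have bound: "((\<lambda>\<epsilon>. \<bar>\<epsilon>\<bar> * (G\<^sup>2 * \<bar>N1 \<epsilon>\<bar> + H\<^sup>2 * \<bar>N2 \<epsilon>\<bar>) / ((G + H) * min G H * (c2 / 2) * P \<epsilon>)) \<longlongrightarrow> 0) (at 0)"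
    by simp
  \<comment> \<open>A priori estimate: the powers of \<open>t\<close> and \<open>1 - t\<close> in
    \<open>R\<close> are bounded by \<open>1\<close>, and \<open>L\<close> by its lower
    bound.\<close>
  have "((\<lambda>\<epsilon>. t \<epsilon> - s) \<longlongrightarrow> 0) (at 0)"
  proof (rule Lim_null_comparison[OF _ bound])
    show "\<forall>\<^sub>F \<epsilon> in at 0. norm (t \<epsilon> - s) \<le>
        \<bar>\<epsilon>\<bar> * (G\<^sup>2 * \<bar>N1 \<epsilon>\<bar> + H\<^sup>2 * \<bar>N2 \<epsilon>\<bar>) / ((G + H) * min G H * (c2 / 2) * P \<epsilon>)"
      using eq pos t01 Lge
    proof eventually_elim
      case (elim \<epsilon>)
      have cube: "\<bar>g * v ^ 3 * n\<bar> \<le> g * \<bar>n\<bar>" if "0 \<le> g" "0 \<le> v" "v \<le> 1" for g v n :: real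
      proof -
        have "\<bar>g * v ^ 3 * n\<bar> = v ^ 3 * (g * \<bar>n\<bar>)"
          using that by (simp add: abs_mult)
        also have "\<dots> \<le> g * \<bar>n\<bar>"
          using that by (intro mult_left_le_one_le) (auto simp: power_le_one)
        finally show ?thesis .
      qed
      have "\<bar>G\<^sup>2 * t \<epsilon> ^ 3 * N1 \<epsilon>\<bar> \<le> G\<^sup>2 * \<bar>N1 \<epsilon>\<bar>" "\<bar>H\<^sup>2 * (1 - t \<epsilon>) ^ 3 * N2 \<epsilon>\<bar> \<le> H\<^sup>2 * \<bar>N2 \<epsilon>\<bar>"
        using elim(3) by (auto intro!: cube)
      then have "\<bar>R \<epsilon>\<bar> \<le> G\<^sup>2 * \<bar>N1 \<epsilon>\<bar> + H\<^sup>2 * \<bar>N2 \<epsilon>\<bar>"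
        unfolding R_def by linarith
      then have "\<bar>\<epsilon>\<bar> * \<bar>R \<epsilon>\<bar> \<le> \<bar>\<epsilon>\<bar> * (G\<^sup>2 * \<bar>N1 \<epsilon>\<bar> + H\<^sup>2 * \<bar>N2 \<epsilon>\<bar>)"
        by (rule mult_left_mono) simp
      moreover have K: "0 < (G + H) * min G H * (c2 / 2) * P \<epsilon>"
        by (rule mult_pos_pos[OF Lpos elim(2)])
      moreover have KL: "(G + H) * min G H * (c2 / 2) * P \<epsilon> \<le> L \<epsilon> * P \<epsilon>"
        using elim(2) by (intro mult_right_mono[OF elim(4)]) simp
      ultimately have "\<bar>\<epsilon>\<bar> * \<bar>R \<epsilon>\<bar> / (L \<epsilon> * P \<epsilon>) \<le>
          \<bar>\<epsilon>\<bar> * (G\<^sup>2 * \<bar>N1 \<epsilon>\<bar> + H\<^sup>2 * \<bar>N2 \<epsilon>\<bar>) / ((G + H) * min G H * (c2 / 2) * P \<epsilon>)"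
        by (intro frac_le mult_nonneg_nonneg add_nonneg_nonneg) simp_all
      moreover have "\<bar>L \<epsilon> * P \<epsilon>\<bar> = L \<epsilon> * P \<epsilon>"
        using K KL by linarith
      ultimately show ?case
        unfolding elim(1) real_norm_def abs_divide abs_mult[of "- \<epsilon>"] abs_minus_cancel by (simp only:)
    qed
  qed
  then have t: "(t \<longlongrightarrow> s) (at 0)"
    by (rule LIM_zero_cancel)
  \<comment> \<open>The limits of the \<open>t\<close>-dependent factors of \<open>L\<close> and
    \<open>R\<close>; their quotient produces \<open>G H / (G + H)\<^sup>2\<close> in the
    slope.\<close>
  have s: "(G + H) * (G * s + H * (1 - s)) = 2 * (G * H)"
    "G\<^sup>2 * s ^ 3 + H\<^sup>2 * (1 - s) ^ 3 = (G * H)\<^sup>2 / (G + H)\<^sup>2"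
  proof -
    have s': "s * (G + H) = H" "(1 - s) * (G + H) = G"
      using G H by (auto simp: s_def field_simps)
    have "(G + H) * (G * s + H * (1 - s)) = G * (s * (G + H)) + H * ((1 - s) * (G + H))"
      by algebra
    also have "\<dots> = 2 * (G * H)"
      unfolding s' by simp
    finally show "(G + H) * (G * s + H * (1 - s)) = 2 * (G * H)" .
    have "(G\<^sup>2 * s ^ 3 + H\<^sup>2 * (1 - s) ^ 3) * (G + H)\<^sup>2 =
        s * (G * (s * (G + H)))\<^sup>2 + (1 - s) * (H * ((1 - s) * (G + H)))\<^sup>2"
      by algebra
    also have "\<dots> = (G * H)\<^sup>2"
      unfolding s' by algebra
    finally have "(G\<^sup>2 * s ^ 3 + H\<^sup>2 * (1 - s) ^ 3) * (G + H)\<^sup>2 = (G * H)\<^sup>2" .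
    then show "G\<^sup>2 * s ^ 3 + H\<^sup>2 * (1 - s) ^ 3 = (G * H)\<^sup>2 / (G + H)\<^sup>2"
      using G H by (simp add: field_simps)
  qed
  have "((\<lambda>\<epsilon>. - R \<epsilon> / (L \<epsilon> * P \<epsilon>)) \<longlongrightarrow>
      - (G\<^sup>2 * s ^ 3 * (S 3 * (c3 / 6)) + H\<^sup>2 * (1 - s) ^ 3 * (S 3 * (c3 / 6))) /
      ((G + H) * (G * s + H * (1 - s)) * (c2 / 2) * S 2)) (at 0)"
    unfolding R_def L_def using G H c2_pos S2 s(1) by (intro tendsto_intros N1 N2 P t) auto
  also have "- (G\<^sup>2 * s ^ 3 * (S 3 * (c3 / 6)) + H\<^sup>2 * (1 - s) ^ 3 * (S 3 * (c3 / 6))) /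
      ((G + H) * (G * s + H * (1 - s)) * (c2 / 2) * S 2) =
      - ((G\<^sup>2 * s ^ 3 + H\<^sup>2 * (1 - s) ^ 3) * (S 3 * (c3 / 6))) / (2 * (G * H) * (c2 / 2) * S 2)"
    unfolding s(1) by (simp add: algebra_simps)
  also have "\<dots> = - c3 / (6 * c2) * (G * H / (G + H)\<^sup>2) * (S 3 / S 2)"
    unfolding s(2) using G H c2_pos S2 by (simp add: divide_simps) (simp add: power2_eq_square)
  also have "S 3 = (\<Sum>x\<in>UNIV. (a - b) $ x ^ 3 / (p $ x)\<^sup>2)"
    unfolding S_def using p by (intro sum.cong) (auto simp: field_simps power2_eq_square power3_eq_cube less_imp_neq[symmetric])
  also have "S 2 = (\<Sum>x\<in>UNIV. ((a - b) $ x)\<^sup>2 / p $ x)"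
    unfolding S_def using p by (intro sum.cong) (auto simp: field_simps power2_eq_square less_imp_neq[symmetric])
  finally have "((\<lambda>\<epsilon>. - R \<epsilon> / (L \<epsilon> * P \<epsilon>)) \<longlongrightarrow> weight_slope G H p (a - b)) (at 0)"
    by (simp only: weight_slope_def)
  then show ?thesis
  proof (rule Lim_transform_eventually)
    show "\<forall>\<^sub>F \<epsilon> in at 0. - R \<epsilon> / (L \<epsilon> * P \<epsilon>) = (t \<epsilon> - H / (G + H)) / \<epsilon>"
      using eq ne by eventually_elim (simp add: s_def)
  qed
qed

section \<open>Local solutions and the expansion of merged states\<close>

lemma eventually_all_pos:
  fixes q :: "real \<Rightarrow> real ^ 'n"
  assumes "(q \<longlongrightarrow> p) F" "\<And>x. p $ x > 0"
  shows "\<forall>\<^sub>F \<epsilon> in F. \<forall>x. q \<epsilon> $ x > 0"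
  using assms by (intro eventually_all_finite order_tendstoD(1)[OF tendsto_vec_nth])

lemma local_solution_exists:
  fixes q r :: "real \<Rightarrow> real ^ 'n" and p a b :: "real ^ 'n"
  assumes q: "((\<lambda>\<epsilon>. (q \<epsilon> - p) /\<^sub>R \<epsilon>) \<longlongrightarrow> a) (at 0)"
    and r: "((\<lambda>\<epsilon>. (r \<epsilon> - p) /\<^sub>R \<epsilon>) \<longlongrightarrow> b) (at 0)"
    and p: "\<And>x. p $ x > 0" and ab: "a \<noteq> b" and G: "G > 0" and H: "H > 0"
  shows "\<exists>t. local_solution f G q H r t"
proof -
  have pos: "\<forall>\<^sub>F \<epsilon> in at 0. \<forall>x. q \<epsilon> $ x > 0" "\<forall>\<^sub>F \<epsilon> in at 0. \<forall>x. r \<epsilon> $ x > 0"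
    using eventually_all_pos[OF tendsto_of_quotient[OF q] p] eventually_all_pos[OF tendsto_of_quotient[OF r] p] .
  have "((\<lambda>\<epsilon>. (q \<epsilon> - p) /\<^sub>R \<epsilon> - (r \<epsilon> - p) /\<^sub>R \<epsilon>) \<longlongrightarrow> a - b) (at 0)"
    by (intro tendsto_diff q r)
  \<comment> \<open>Different first-order terms separate the two densities for small \<epsilon>, as
    uniqueness requires.\<close>
  then have "\<forall>\<^sub>F \<epsilon> in at 0. (q \<epsilon> - p) /\<^sub>R \<epsilon> - (r \<epsilon> - p) /\<^sub>R \<epsilon> \<noteq> 0"
    using ab by (intro tendsto_imp_eventually_ne) auto
  then have qr: "\<forall>\<^sub>F \<epsilon> in at 0. q \<epsilon> \<noteq> r \<epsilon>"
    by (rule eventually_mono) auto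
  \<comment> \<open>An arbitrary choice is enough: \<open>balancing_weight_slope\<close> forces it
    to converge to \<open>H / (G + H)\<close>.\<close>
  define t where "t \<epsilon> = (SOME s. balances f G (q \<epsilon>) H (r \<epsilon>) s)" for \<epsilon>
  have bal: "\<forall>\<^sub>F \<epsilon> in at 0. balances f G (q \<epsilon>) H (r \<epsilon>) (t \<epsilon>)"
    using pos unfolding t_def by eventually_elim (rule someI_ex, rule balances_exists, blast+)
  have "((\<lambda>\<epsilon>. (t \<epsilon> - H / (G + H)) /\<^sub>R \<epsilon>) \<longlongrightarrow> weight_slope G H p (a - b)) (at 0)"
    using balancing_weight_slope[OF q r p ab G H bal] by (simp only: real_scaleR_def divide_inverse_commute)
  from tendsto_of_quotient[OF this] have "(t \<longlongrightarrow> H / (G + H)) (at 0)" .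
  \<comment> \<open>Balancing weights are unique on all of \<open>[0, 1]\<close>, so any radius
    works; \<open>1\<close> is taken.\<close>
  moreover have "\<forall>\<^sub>F \<epsilon> in at 0. balances f G (q \<epsilon>) H (r \<epsilon>) (t \<epsilon>) \<and>
      (\<forall>s\<in>ball (H / (G + H)) 1. balances f G (q \<epsilon>) H (r \<epsilon>) s \<longrightarrow> s = t \<epsilon>)"
    using bal pos qr by eventually_elim (metis balances_unique G H)
  ultimately show ?thesis
    unfolding local_solution_def by (intro exI[of _ t] conjI exI[of _ 1]) auto
qed

lemma local_solution_expands:
  assumes "expands_to_second_order q p a a'" "expands_to_second_order r p b b'"
    and "\<And>x. p $ x > 0" "a \<noteq> b" "G > 0" "H > 0" "local_solution f G q H r t"
  shows "expands_to_second_order (\<lambda>\<epsilon>. mixture (q \<epsilon>) (r \<epsilon>) (t \<epsilon>)) p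
    (mixture a b (H / (G + H))) (mixture a' b' (H / (G + H)) + weight_slope G H p (a - b) *\<^sub>R (b - a))"
proof -
  have "\<forall>\<^sub>F \<epsilon> in at 0. balances f G (q \<epsilon>) H (r \<epsilon>) (t \<epsilon>)"
    using assms(7) unfolding local_solution_def by (auto elim: eventually_mono)
  from balancing_weight_slope[OF assms(1,2)[THEN expands_to_second_order_first] assms(3-6) this]
  show ?thesis
    by (rule mixture_expands_to_second_order[OF assms(1,2)])
qed

lemma protocol_output_Merge_exists:
  assumes "protocol_output f w \<rho> L G q" "protocol_output f w \<rho> R H r"
    and "expands_to_second_order q p a a'" "expands_to_second_order r p b b'"
    and "\<And>x. p $ x > 0" "a \<noteq> b" "G > 0" "H > 0"
  shows "\<exists>F. protocol_output f w \<rho> (Merge L R) (G + H) F"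
  using local_solution_exists[OF assms(3,4)[THEN expands_to_second_order_first] assms(5-8)]
    protocol_output.Merge[OF assms(1,2)] by blast

end

section \<open>The three-point configuration\<close>

inductive_cases protocol_output_LeafE: "protocol_output f w \<rho> (Leaf i) G q"
inductive_cases protocol_output_MergeE: "protocol_output f w \<rho> (Merge L R) G q"

theorem theorem8:
  fixes \<alpha> :: real and f :: "real \<Rightarrow> real"
    and p :: "real ^ 3" and w :: "3 \<Rightarrow> real" and h :: "3 \<Rightarrow> real ^ 3"
    and p\<epsilon> :: "3 \<Rightarrow> real \<Rightarrow> real ^ 3"
  assumes "\<alpha> \<noteq> 0"
    and "p = vector [1/3, 1/3, 1/3]"
    and "w = (\<lambda>_. 1)"
    and "h 1 = \<alpha> *\<^sub>R vector [2, -1, -1]"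
    and "h 2 = \<alpha> *\<^sub>R vector [-1, 2, -1]"
    and "h 3 = \<alpha> *\<^sub>R vector [-1, -1, 2]"
    and "p\<epsilon> = (\<lambda>i \<epsilon>. p + \<epsilon> *\<^sub>R h i)"
    and "convex_on {0<..} f"
    and "\<exists>U. open U \<and> 1 \<in> U \<and> U \<subseteq> {0<..} \<and> C_k_on 3 f U"
    and "f 1 = 0" and "deriv f 1 = 0"
    and "(deriv ^^ 2) f 1 > 0" and "(deriv ^^ 3) f 1 \<noteq> 0"
  shows "(\<exists>G F. protocol_output f w p\<epsilon> (Merge (Merge (Leaf 1) (Leaf 2)) (Leaf 3)) G F) \<and>
    (\<exists>G F. protocol_output f w p\<epsilon> (Merge (Leaf 1) (Merge (Leaf 2) (Leaf 3))) G F) \<and>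
    (\<forall>G G' F12_3 F1_23.
       protocol_output f w p\<epsilon> (Merge (Merge (Leaf 1) (Leaf 2)) (Leaf 3)) G F12_3 \<longrightarrow>
       protocol_output f w p\<epsilon> (Merge (Leaf 1) (Merge (Leaf 2) (Leaf 3))) G' F1_23 \<longrightarrow>
       (\<lambda>\<epsilon>. norm (F12_3 \<epsilon> - F1_23 \<epsilon> -
          (- (\<epsilon>\<^sup>2 * (3 * \<alpha>\<^sup>2 / 4) * ((deriv ^^ 3) f 1 / (deriv ^^ 2) f 1)) *\<^sub>R vector [1, 0, -1])))
         \<in> o[at 0](\<lambda>\<epsilon>. \<epsilon>\<^sup>2))"
proof -
  define c2 c3 where "c2 = (deriv ^^ 2) f 1" and "c3 = (deriv ^^ 3) f 1"
  obtain U where U: "open U" "1 \<in> U" "C_k_on 3 f U"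
    using assms(9) by blast
  interpret divergence_generator f c2 c3
    using assms C_k_on_3_expansion[OF U(3,1,2)] by unfold_locales (auto simp: c2_def c3_def)
  have p: "p $ x > 0" for x
    using assms(2) exhaust_3[of x] by (auto simp: vector_3)
  have leaf: "expands_to_second_order (p\<epsilon> i) p (h i) 0" for i
    using expands_to_second_order_affine[of p "h i"] assms(7) by simp
  have ne: "h 1 \<noteq> h 2" "h 2 \<noteq> h 3" "mixture (h 1) (h 2) (1/2) \<noteq> h 3" "h 1 \<noteq> mixture (h 2) (h 3) (1/2)"
    using assms(1,4-6) by (auto simp: vec_eq_iff forall_3 mixture_nth vector_3)
  \<comment> \<open>The differences are \<open>3 \<alpha>\<close> times (1, -1, 0) and (0, 1, -1);
    with \<open>p\<close> uniform their cubes cancel.\<close>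
  have slope_pair: "weight_slope 1 1 p (h 1 - h 2) = 0" "weight_slope 1 1 p (h 2 - h 3) = 0"
    using assms(2,4-6) by (simp_all add: weight_slope_def sum_3 vector_3)
  \<comment> \<open>As the three directions sum to zero, the differences are \<open>-3/2\<close>
    times \<open>h 3\<close> and \<open>3/2\<close> times \<open>h 1\<close>. The quotients of cubic
    by quadratic sums are \<open>-9 \<alpha> / 2\<close> and \<open>9 \<alpha> / 2\<close>, hence
    the opposite signs.\<close>
  have slope_left: "weight_slope 2 1 p (mixture (h 1) (h 2) (1/2) - h 3) = \<alpha> * c3 / (6 * c2)"
    and slope_right: "weight_slope 1 2 p (h 1 - mixture (h 2) (h 3) (1/2)) = - \<alpha> * c3 / (6 * c2)"
    using assms(1,2,4-6) c2_pos
    by (simp_all add: weight_slope_def sum_3 vector_3 mixture_nth power2_eq_square power3_eq_cube field_simps)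
  have leaf_output: "protocol_output f w p\<epsilon> (Leaf i) 1 (p\<epsilon> i)" for i
    using protocol_output.Leaf[of f w p\<epsilon> i] assms(3) by simp
  have leaf_cases: "G = 1 \<and> q = p\<epsilon> i" if "protocol_output f w p\<epsilon> (Leaf i) G q" for G q i
    using that assms(3) by (auto elim: protocol_output_LeafE)
  have pair: "G = 2 \<and> expands_to_second_order q p (mixture (h i) (h j) (1/2)) 0"
    if "protocol_output f w p\<epsilon> (Merge (Leaf i) (Leaf j)) G q" "h i \<noteq> h j" "weight_slope 1 1 p (h i - h j) = 0"
    for G q i j
    using that(1)
  proof (rule protocol_output_MergeE)
    fix G\<^sub>A q\<^sub>A G\<^sub>B q\<^sub>B t
    assume *: "G = G\<^sub>A + G\<^sub>B" "q = (\<lambda>\<epsilon>. mixture (q\<^sub>A \<epsilon>) (q\<^sub>B \<epsilon>) (t \<epsilon>))"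
      "protocol_output f w p\<epsilon> (Leaf i) G\<^sub>A q\<^sub>A" "protocol_output f w p\<epsilon> (Leaf j) G\<^sub>B q\<^sub>B"
      "local_solution f G\<^sub>A q\<^sub>A G\<^sub>B q\<^sub>B t"
    then have "local_solution f 1 (p\<epsilon> i) 1 (p\<epsilon> j) t"
      using leaf_cases by blast
    from local_solution_expands[OF leaf leaf p that(2) _ _ this] show ?thesis
      using * leaf_cases[OF *(3)] leaf_cases[OF *(4)] that(3) by (simp add: mixture_self)
  qed
  define k where "k = \<alpha> * c3 / (6 * c2)"
  have left: "expands_to_second_order q p 0 (k *\<^sub>R (h 3 - mixture (h 1) (h 2) (1/2)))"
    if "protocol_output f w p\<epsilon> (Merge (Merge (Leaf 1) (Leaf 2)) (Leaf 3)) G q" for G q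
    using that
  proof (rule protocol_output_MergeE)
    fix G\<^sub>A q\<^sub>A G\<^sub>B q\<^sub>B t
    assume *: "q = (\<lambda>\<epsilon>. mixture (q\<^sub>A \<epsilon>) (q\<^sub>B \<epsilon>) (t \<epsilon>))"
      "protocol_output f w p\<epsilon> (Merge (Leaf 1) (Leaf 2)) G\<^sub>A q\<^sub>A" "protocol_output f w p\<epsilon> (Leaf 3) G\<^sub>B q\<^sub>B"
      "local_solution f G\<^sub>A q\<^sub>A G\<^sub>B q\<^sub>B t"
    note A = pair[OF *(2) ne(1) slope_pair(1)] and B = leaf_cases[OF *(3)]
    then have "local_solution f 2 q\<^sub>A 1 (p\<epsilon> 3) t"
      using *(4) by blast
    from local_solution_expands[OF A[THEN conjunct2] leaf p ne(3) _ _ this]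
    have "expands_to_second_order q p (mixture (mixture (h 1) (h 2) (1/2)) (h 3) (1/3)) (k *\<^sub>R (h 3 - mixture (h 1) (h 2) (1/2)))"
      using *(1) B slope_left by (simp add: k_def mixture_self)
    \<comment> \<open>The limiting weights give each leaf an equal share, and the directions sum to
      zero; the first-order term disappears.\<close>
    moreover have "mixture (mixture (h 1) (h 2) (1/2)) (h 3) (1/3) = 0"
      using assms(4-6) by (simp add: vec_eq_iff forall_3 mixture_nth vector_3)
    ultimately show ?thesis by simp
  qed
  have right: "expands_to_second_order q p 0 (- k *\<^sub>R (mixture (h 2) (h 3) (1/2) - h 1))"
    if "protocol_output f w p\<epsilon> (Merge (Leaf 1) (Merge (Leaf 2) (Leaf 3))) G q" for G q
    using that
  proof (rule protocol_output_MergeE)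
    fix G\<^sub>A q\<^sub>A G\<^sub>B q\<^sub>B t
    assume *: "q = (\<lambda>\<epsilon>. mixture (q\<^sub>A \<epsilon>) (q\<^sub>B \<epsilon>) (t \<epsilon>))"
      "protocol_output f w p\<epsilon> (Leaf 1) G\<^sub>A q\<^sub>A" "protocol_output f w p\<epsilon> (Merge (Leaf 2) (Leaf 3)) G\<^sub>B q\<^sub>B"
      "local_solution f G\<^sub>A q\<^sub>A G\<^sub>B q\<^sub>B t"
    note A = leaf_cases[OF *(2)] and B = pair[OF *(3) ne(2) slope_pair(2)]
    then have "local_solution f 1 (p\<epsilon> 1) 2 q\<^sub>B t"
      using *(4) by blast
    from local_solution_expands[OF leaf B[THEN conjunct2] p ne(4) _ _ this]
    have "expands_to_second_order q p (mixture (h 1) (mixture (h 2) (h 3) (1/2)) (2/3)) (- k *\<^sub>R (mixture (h 2) (h 3) (1/2) - h 1))"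
      using *(1) A slope_right by (simp add: k_def mixture_self)
    moreover have "mixture (h 1) (mixture (h 2) (h 3) (1/2)) (2/3) = 0"
      using assms(4-6) by (simp add: vec_eq_iff forall_3 mixture_nth vector_3)
    ultimately show ?thesis by simp
  qed
  obtain q12 q23 where
    "protocol_output f w p\<epsilon> (Merge (Leaf 1) (Leaf 2)) 2 q12"
    "protocol_output f w p\<epsilon> (Merge (Leaf 2) (Leaf 3)) 2 q23"
    using protocol_output_Merge_exists[OF leaf_output leaf_output leaf leaf p ne(1)]
      protocol_output_Merge_exists[OF leaf_output leaf_output leaf leaf p ne(2)] by auto
  note out = this
  have ex: "expands_to_second_order q12 p (mixture (h 1) (h 2) (1/2)) 0"
    "expands_to_second_order q23 p (mixture (h 2) (h 3) (1/2)) 0"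
    using pair[OF out(1) ne(1) slope_pair(1)] pair[OF out(2) ne(2) slope_pair(2)] by auto
  have "\<exists>F. protocol_output f w p\<epsilon> (Merge (Merge (Leaf 1) (Leaf 2)) (Leaf 3)) (2 + 1) F"
    "\<exists>F. protocol_output f w p\<epsilon> (Merge (Leaf 1) (Merge (Leaf 2) (Leaf 3))) (1 + 2) F"
    using protocol_output_Merge_exists[OF out(1) leaf_output ex(1) leaf p ne(3)]
      protocol_output_Merge_exists[OF leaf_output out(2) leaf ex(2) p ne(4)] by auto
  moreover have "(\<lambda>\<epsilon>. norm (F \<epsilon> - F' \<epsilon> - (- (\<epsilon>\<^sup>2 * (3 * \<alpha>\<^sup>2 / 4) * (c3 / c2)) *\<^sub>R vector [1, 0, -1])))
      \<in> o[at 0](\<lambda>\<epsilon>. \<epsilon>\<^sup>2)"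
    if "protocol_output f w p\<epsilon> (Merge (Merge (Leaf 1) (Leaf 2)) (Leaf 3)) G F"
      "protocol_output f w p\<epsilon> (Merge (Leaf 1) (Merge (Leaf 2) (Leaf 3))) G' F'" for G G' F F'
  proof -
    define v :: "real ^ 3" where "v = - (3 * \<alpha>\<^sup>2 / 4 * (c3 / c2)) *\<^sub>R vector [1, 0, -1]"
    \<comment> \<open>The left side equals \<open>3/2 k (h 3 - h 1)\<close>, that is
      \<open>- 9/2 k \<alpha>\<close> times (1, 0, -1); inserting \<open>k\<close> gives the
      constant \<open>3/4\<close>.\<close>
    have "k *\<^sub>R (h 3 - mixture (h 1) (h 2) (1/2)) - (- k *\<^sub>R (mixture (h 2) (h 3) (1/2) - h 1)) = v"
      using assms(4-6) by (simp add: v_def k_def vec_eq_iff forall_3 mixture_nth vector_3 power2_eq_square)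
    then have "((\<lambda>\<epsilon>. (F \<epsilon> - p - \<epsilon> *\<^sub>R 0) /\<^sub>R \<epsilon>\<^sup>2 - (F' \<epsilon> - p - \<epsilon> *\<^sub>R 0) /\<^sub>R \<epsilon>\<^sup>2) \<longlongrightarrow> v) (at 0)"
      using tendsto_diff[OF left[OF that(1), unfolded expands_to_second_order_def]
          right[OF that(2), unfolded expands_to_second_order_def]] by metis
    then have lim: "((\<lambda>\<epsilon>. norm ((F \<epsilon> - p - \<epsilon> *\<^sub>R 0) /\<^sub>R \<epsilon>\<^sup>2 - (F' \<epsilon> - p - \<epsilon> *\<^sub>R 0) /\<^sub>R \<epsilon>\<^sup>2 - v)) \<longlongrightarrow> 0) (at 0)"
      by (simp add: tendsto_norm_zero LIM_zero)
    have "norm ((F \<epsilon> - p - \<epsilon> *\<^sub>R 0) /\<^sub>R \<epsilon>\<^sup>2 - (F' \<epsilon> - p - \<epsilon> *\<^sub>R 0) /\<^sub>R \<epsilon>\<^sup>2 - v) =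
        norm (F \<epsilon> - F' \<epsilon> - (- (\<epsilon>\<^sup>2 * (3 * \<alpha>\<^sup>2 / 4) * (c3 / c2)) *\<^sub>R vector [1, 0, -1])) / \<epsilon>\<^sup>2"
      if "\<epsilon> \<noteq> 0" for \<epsilon>
    proof -
      have "(F \<epsilon> - p - \<epsilon> *\<^sub>R 0) /\<^sub>R \<epsilon>\<^sup>2 - (F' \<epsilon> - p - \<epsilon> *\<^sub>R 0) /\<^sub>R \<epsilon>\<^sup>2 - v =
        (F \<epsilon> - F' \<epsilon> - (- (\<epsilon>\<^sup>2 * (3 * \<alpha>\<^sup>2 / 4) * (c3 / c2)) *\<^sub>R vector [1, 0, -1])) /\<^sub>R \<epsilon>\<^sup>2"
        using that by (simp add: v_def vec_eq_iff field_simps)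
      moreover have "norm (z /\<^sub>R \<epsilon>\<^sup>2) = norm z / \<epsilon>\<^sup>2" for z :: "real ^ 3"
        by (simp add: divide_inverse_commute)
      ultimately show ?thesis
        by (simp only:)
    qed
    from iffD1[OF LIM_equal, OF allI[OF impI[OF this]] lim]
    have "((\<lambda>\<epsilon>. norm (F \<epsilon> - F' \<epsilon> - (- (\<epsilon>\<^sup>2 * (3 * \<alpha>\<^sup>2 / 4) * (c3 / c2)) *\<^sub>R vector [1, 0, -1])) / \<epsilon>\<^sup>2)
        \<longlongrightarrow> 0) (at 0)"
      .
    then show ?thesis
      by (rule smalloI_tendsto) (simp add: eventually_at_filter)
  qed
  ultimately show ?thesis
    unfolding c2_def c3_def by blast
qed

end
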